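(* Let $P$ be a finite pure poset of rank $r$ and let $f:P\to\mathbb{N}_0$ be a function. Then $f$ belongs to $C_P$ if and only if the bipartite graph $G_i(P)^f$ has a perfect matching for all $i=0,\ldots,r-1$.
   Context: $\mathbb{N}_0=\{0,1,2,\dots\}$ and $\mathbb{K}$ is a field. The length of a chain $C$ in a finite poset is $|C|-1$. A finite poset $P$ is pure of rank $r$ if every maximal chain of $P$ has length $r$. For $x<y$ in $P$, $y$ covers $x$ if there is no $z$ with $x<z<y$. A pure poset has a unique rank function $\rho:P\to\mathbb{N}_0$ with $\rho(m)=0$ for minimal $m$ and $\rho(y)=\rho(x)+1$ whenever $y$ covers $x$. Set $P_i=\{a\in P: \rho(a)=i\}$ for $0\le i\le r$. Let $R=\mathbb{K}[x : x\in P]$ be the polynomial ring with variables the elements of $P$. To each maximal chain $C: x_0<x_1<\cdots<x_r$ associate the monomial $x_C=x_0x_1\cdots x_r\in R$. The chain algebra $\mathbb{K}[C_P]$ is the $\mathbb{K}$-subalgebra of $R$ generated by all $x_C$, with $C$ a maximal chain of $P$. The chain semigroup $C_P$ is the set of all functions $f:P\to\mathbb{N}_0$ such that $\prod_{x\in P}x^{f(x)}\in\mathbb{K}[C_P]$. For $S\subseteq P$ non-empty, $S^f=\bigsqcup_{x\in S}\{x^{[1]},\ldots,x^{[f(x)]}\}$ (disjoint copies of $x$, $f(x)$ many; no copies if $f(x)=0$). The graph $G_i(P)^f$ (the $f$-parallelization of the covering graph between ranks $i$ and $i+1$) is the bipartite graph with bipartition $(P_i^f,P_{i+1}^f)$ in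 which $x^{[k]}\in P_i^f$ is adjacent to $y^{[\ell]}\in P_{i+1}^f$ if and only if $y$ covers $x$. A perfect matching of a bipartite graph with partition $(V_1,V_2)$ is a bijection $\phi:V_1\to V_2$ such that each $a\in V_1$ is adjacent to $\phi(a)$ (if $V_1=V_2=\emptyset$ the empty map is a perfect matching). *)

theory Defs
  imports HOL.Hull "HOL-Library.Poly_Mapping" "HOL-Library.FuncSet"
begin

section \<open>Finite posets\<close>

text \<open>A poset is a carrier set \<open>P\<close> with a relation \<open>le\<close> such that \<^term>\<open>partial_order_on P le\<close>.\<close>

definition lt_in :: "'a rel \<Rightarrow> 'a \<Rightarrow> 'a \<Rightarrow> bool" where
  "lt_in le x y \<longleftrightarrow> (x, y) \<in> le \<and> x \<noteq> y"

definition covers :: "'a set \<Rightarrow> 'a rel \<Rightarrow> 'a \<Rightarrow> 'a \<Rightarrow> bool" where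
  "covers P le y x \<longleftrightarrow>
     x \<in> P \<and> y \<in> P \<and> lt_in le x y \<and> \<not> (\<exists>z\<in>P. lt_in le x z \<and> lt_in le z y)"

definition minimal_in :: "'a set \<Rightarrow> 'a rel \<Rightarrow> 'a \<Rightarrow> bool" where
  "minimal_in P le m \<longleftrightarrow> m \<in> P \<and> \<not> (\<exists>z\<in>P. lt_in le z m)"

definition max_chains :: "'a set \<Rightarrow> 'a rel \<Rightarrow> 'a set set" where
  "max_chains P le = {C. pred_on.maxchain P (lt_in le) C}"

text \<open>Integer-valued, so that the empty chain has length \<open>-1\<close>. In particular the empty poset, whose
  only maximal chain is empty, is not pure of any rank.\<close>

definition chain_length :: "'a set \<Rightarrow> int" where
  "chain_length C = int (card C) - 1"

definition pure_of_rank :: "'a set \<Rightarrow> 'a rel \<Rightarrow> nat \<Rightarrow> bool" where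
  "pure_of_rank P le r \<longleftrightarrow> (\<forall>C \<in> max_chains P le. chain_length C = int r)"

definition is_rank_function :: "'a set \<Rightarrow> 'a rel \<Rightarrow> ('a \<Rightarrow> nat) \<Rightarrow> bool" where
  "is_rank_function P le \<rho> \<longleftrightarrow>
     (\<forall>m. minimal_in P le m \<longrightarrow> \<rho> m = 0) \<and>
     (\<forall>x y. covers P le y x \<longrightarrow> \<rho> y = \<rho> x + 1)"

text \<open>\<^const>\<open>extensional\<close> fixes the irrelevant values outside \<open>P\<close>, so that the description is unique;
  see \<open>rank_function_exists_unique\<close> below for the fact that it denotes for pure posets.\<close>

definition rank_of :: "'a set \<Rightarrow> 'a rel \<Rightarrow> 'a \<Rightarrow> nat" where
  "rank_of P le = (THE \<rho>. \<rho> \<in> extensional P \<and> is_rank_function P le \<rho>)"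

definition level :: "'a set \<Rightarrow> 'a rel \<Rightarrow> nat \<Rightarrow> 'a set" where
  "level P le i = {a \<in> P. rank_of P le a = i}"


section \<open>The chain algebra and the chain semigroup\<close>

text \<open>Monomials are finitely supported exponent functions, polynomials are finitely supported
  coefficient functions on monomials, multiplied by convolution.\<close>

type_synonym ('a, 'k) mpolynomial = "('a \<Rightarrow>\<^sub>0 nat) \<Rightarrow>\<^sub>0 'k"

definition poly_var :: "'a \<Rightarrow> ('a, 'k::field) mpolynomial" where
  "poly_var x = Poly_Mapping.single (Poly_Mapping.single x 1) 1"

definition poly_const :: "'k \<Rightarrow> ('a, 'k::field) mpolynomial" where
  "poly_const c = Poly_Mapping.single 0 c"

definition poly_ring :: "'a set \<Rightarrow> ('a, 'k::field) mpolynomial set" where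
  "poly_ring P = {p. \<forall>m \<in> Poly_Mapping.keys p. Poly_Mapping.keys m \<subseteq> P}"

definition is_subalgebra :: "'a set \<Rightarrow> ('a, 'k::field) mpolynomial set \<Rightarrow> bool" where
  "is_subalgebra P A \<longleftrightarrow>
     A \<subseteq> poly_ring P \<and> 1 \<in> A \<and>
     (\<forall>p\<in>A. \<forall>q\<in>A. p + q \<in> A \<and> p * q \<in> A) \<and>
     (\<forall>c. \<forall>p\<in>A. poly_const c * p \<in> A)"

definition chain_monomial :: "'a set \<Rightarrow> ('a, 'k::field) mpolynomial" where
  "chain_monomial C = (\<Prod>x\<in>C. poly_var x)"

definition chain_algebra :: "'a set \<Rightarrow> 'a rel \<Rightarrow> ('a, 'k::field) mpolynomial set" where
  "chain_algebra P le = is_subalgebra P hull (chain_monomial ` max_chains P le)"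

text \<open>A function \<open>P \<rightarrow> \<nat>\<close> is represented by a total function on the type, of which only the values
  on \<open>P\<close> are used. The argument of type \<^typ>\<open>'k itself\<close> names the coefficient field.\<close>

definition chain_semigroup ::
  "'k::field itself \<Rightarrow> 'a set \<Rightarrow> 'a rel \<Rightarrow> ('a \<Rightarrow> nat) set" where
  "chain_semigroup K P le =
     {f. (\<Prod>x\<in>P. poly_var x ^ f x) \<in> (chain_algebra P le :: ('a, 'k) mpolynomial set)}"


section \<open>Bipartite graphs and parallelizations\<close>

text \<open>A bipartite graph is given by its two sides and its edges, oriented from the first side
  to the second.\<close>

type_synonym 'v bipartite = "'v set \<times> 'v set \<times> ('v \<times> 'v) set"

definition perfect_matching :: "'v bipartite \<Rightarrow> ('v \<Rightarrow> 'v) \<Rightarrow> bool" where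
  "perfect_matching G \<phi> = (case G of (V1, V2, E) \<Rightarrow>
     bij_betw \<phi> V1 V2 \<and> (\<forall>a\<in>V1. (a, \<phi> a) \<in> E))"

text \<open>The pair \<open>(x, k)\<close> is the \<open>k\<close>-th copy of \<open>x\<close>.\<close>

definition copies :: "('a \<Rightarrow> nat) \<Rightarrow> 'a set \<Rightarrow> ('a \<times> nat) set" where
  "copies f S = (SIGMA x:S. {1..f x})"

definition parallel_graph ::
  "'a set \<Rightarrow> 'a rel \<Rightarrow> ('a \<Rightarrow> nat) \<Rightarrow> nat \<Rightarrow> ('a \<times> nat) bipartite" where
  "parallel_graph P le f i =
     (let V1 = copies f (level P le i); V2 = copies f (level P le (i + 1))
      in (V1, V2, {((x, k), (y, l)) | x k y l.
                     (x, k) \<in> V1 \<and> (y, l) \<in> V2 \<and> covers P le y x}))"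


section \<open>The rank function is well defined\<close>

lemma chain_iff:
  "pred_on.chain P (lt_in le) C \<longleftrightarrow>
     C \<subseteq> P \<and> (\<forall>x\<in>C. \<forall>y\<in>C. x = y \<or> (x, y) \<in> le \<or> (y, x) \<in> le)"
  unfolding pred_on.chain_def lt_in_def by auto

lemma mem_max_chains_iff:
  "C \<in> max_chains P le \<longleftrightarrow>
     pred_on.chain P (lt_in le) C \<and>
     (\<forall>z\<in>P. (\<forall>c\<in>C. z = c \<or> (z, c) \<in> le \<or> (c, z) \<in> le) \<longrightarrow> z \<in> C)"
proof
  assume C: "C \<in> max_chains P le"
  hence ch: "pred_on.chain P (lt_in le) C"
    and mx: "\<not> (\<exists>S. pred_on.chain P (lt_in le) S \<and> C \<subset> S)"
    by (auto simp: max_chains_def pred_on.maxchain_def)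
  have "z \<in> C" if z: "z \<in> P" "\<forall>c\<in>C. z = c \<or> (z, c) \<in> le \<or> (c, z) \<in> le" for z
  proof (rule ccontr)
    assume "z \<notin> C"
    moreover have "pred_on.chain P (lt_in le) (insert z C)"
      using ch z unfolding chain_iff by auto
    ultimately show False using mx by blast
  qed
  with ch show "pred_on.chain P (lt_in le) C \<and>
     (\<forall>z\<in>P. (\<forall>c\<in>C. z = c \<or> (z, c) \<in> le \<or> (c, z) \<in> le) \<longrightarrow> z \<in> C)" by blast
next
  assume R: "pred_on.chain P (lt_in le) C \<and>
     (\<forall>z\<in>P. (\<forall>c\<in>C. z = c \<or> (z, c) \<in> le \<or> (c, z) \<in> le) \<longrightarrow> z \<in> C)"
  have "\<not> (pred_on.chain P (lt_in le) S \<and> C \<subset> S)" for S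
  proof
    assume S: "pred_on.chain P (lt_in le) S \<and> C \<subset> S"
    then obtain z where z: "z \<in> S" "z \<notin> C" by blast
    have "z \<in> P" "\<forall>c\<in>C. z = c \<or> (z, c) \<in> le \<or> (c, z) \<in> le"
      using S z(1) unfolding chain_iff by (meson psubsetD subsetD)+
    with R z(2) show False by blast
  qed
  with R show "C \<in> max_chains P le"
    by (auto simp: max_chains_def pred_on.maxchain_def)
qed

lemma max_chains_nonempty: "\<exists>C. C \<in> max_chains P le"
  unfolding max_chains_def using pred_on.Hausdorff by blast

theorem rank_function_exists_unique:
  assumes fin: "finite P" and po: "partial_order_on P le" and pure: "pure_of_rank P le r"
  shows "\<exists>!\<rho>. \<rho> \<in> extensional P \<and> is_rank_function P le \<rho>"
proof -
  note R = partial_order_onD[OF po]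
  define D where "D x = {z\<in>P. lt_in le z x}" for x
  define U where "U x = {z\<in>P. (x, z) \<in> le}" for x
  have tr: "(a, c) \<in> le" if "(a, b) \<in> le" "(b, c) \<in> le" for a b c
    using R(2) that by (auto dest: transD)
  have as: "a = b" if "(a, b) \<in> le" "(b, a) \<in> le" for a b
    using R(3) that by (auto dest: antisymD)
  have card_sum: "card A + card B = r + 1"
    if x: "x \<in> P" and A: "A \<in> max_chains (D x) le" and B: "B \<in> max_chains (U x) le"
    for x A B
  proof -
    have A': "A \<subseteq> D x" "\<forall>a\<in>A. \<forall>b\<in>A. a = b \<or> (a, b) \<in> le \<or> (b, a) \<in> le"
      "\<And>z. z \<in> D x \<Longrightarrow> (\<forall>c\<in>A. z = c \<or> (z, c) \<in> le \<or> (c, z) \<in> le) \<Longrightarrow> z \<in> A"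
      using A unfolding mem_max_chains_iff chain_iff by blast+
    have B': "B \<subseteq> U x" "\<forall>a\<in>B. \<forall>b\<in>B. a = b \<or> (a, b) \<in> le \<or> (b, a) \<in> le"
      "\<And>z. z \<in> U x \<Longrightarrow> (\<forall>c\<in>B. z = c \<or> (z, c) \<in> le \<or> (c, z) \<in> le) \<Longrightarrow> z \<in> B"
      using B unfolding mem_max_chains_iff chain_iff by blast+
    have "(x, x) \<in> le" using R(1) x by (auto simp: refl_on_def)
    hence xB: "x \<in> B" using B' x by (fastforce simp: U_def)
    have le_ab: "(a, b) \<in> le" if "a \<in> A" "b \<in> B" for a b
      using that A' B' tr unfolding D_def U_def lt_in_def by blast
    have dis: "A \<inter> B = {}" using A'(1) B'(1) as by (auto simp: D_def U_def lt_in_def)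
    have "A \<union> B \<in> max_chains P le"
      unfolding mem_max_chains_iff chain_iff
    proof (intro conjI ballI impI)
      show "A \<union> B \<subseteq> P" using A'(1) B'(1) by (auto simp: D_def U_def)
    next
      fix a b assume "a \<in> A \<union> B" "b \<in> A \<union> B"
      thus "a = b \<or> (a, b) \<in> le \<or> (b, a) \<in> le" using A'(2) B'(2) le_ab by blast
    next
      fix z assume z: "z \<in> P" "\<forall>c\<in>A \<union> B. z = c \<or> (z, c) \<in> le \<or> (c, z) \<in> le"
      with xB have "z = x \<or> (z, x) \<in> le \<or> (x, z) \<in> le" by blast
      hence "z \<in> D x \<or> z \<in> U x"
        using z(1) \<open>(x, x) \<in> le\<close> by (auto simp: D_def U_def lt_in_def)
      thus "z \<in> A \<union> B" using A'(3)[of z] B'(3)[of z] z(2) by blast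
    qed
    hence "card (A \<union> B) = r + 1"
      using pure unfolding pure_of_rank_def chain_length_def by force
    moreover have "finite A" "finite B"
      using A'(1) B'(1) fin by (auto simp: D_def U_def intro: finite_subset)
    ultimately show ?thesis using dis by (simp add: card_Un_disjoint)
  qed
  have card_eq: "card A = card A'"
    if "x \<in> P" "A \<in> max_chains (D x) le" "A' \<in> max_chains (D x) le" for x A A'
  proof -
    obtain B where "B \<in> max_chains (U x) le" using max_chains_nonempty by blast
    thus ?thesis using card_sum[OF that(1,2)] card_sum[OF that(1,3)] by fastforce
  qed
  define \<rho> where "\<rho> = restrict (\<lambda>x. card (SOME A. A \<in> max_chains (D x) le)) P"
  have rho: "\<rho> x = card A" if "x \<in> P" "A \<in> max_chains (D x) le" for x A
    using that card_eq[OF that(1) someI[of "\<lambda>A. A \<in> max_chains (D x) le", OF that(2)] that(2)]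
    by (simp add: \<rho>_def)
  have ex: "is_rank_function P le \<rho>"
    unfolding is_rank_function_def
  proof (intro conjI allI impI)
    fix m assume m: "minimal_in P le m"
    hence "D m = {}" by (auto simp: D_def minimal_in_def)
    hence "{} \<in> max_chains (D m) le" by (simp add: mem_max_chains_iff chain_iff)
    thus "\<rho> m = 0" using rho[of m "{}"] m by (simp add: minimal_in_def)
  next
    fix x y assume c: "covers P le y x"
    hence xy: "x \<in> P" "y \<in> P" "(x, y) \<in> le" "x \<noteq> y"
      and nz: "\<And>z. z \<in> P \<Longrightarrow> lt_in le x z \<Longrightarrow> lt_in le z y \<Longrightarrow> False"
      by (auto simp: covers_def lt_in_def)
    obtain A where A: "A \<in> max_chains (D x) le" using max_chains_nonempty by blast
    hence A': "A \<subseteq> D x" "\<forall>a\<in>A. \<forall>b\<in>A. a = b \<or> (a, b) \<in> le \<or> (b, a) \<in> le"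
      "\<And>z. z \<in> D x \<Longrightarrow> (\<forall>c\<in>A. z = c \<or> (z, c) \<in> le \<or> (c, z) \<in> le) \<Longrightarrow> z \<in> A"
      unfolding mem_max_chains_iff chain_iff by blast+
    have sub: "D x \<subseteq> D y" using tr as xy by (auto simp: D_def lt_in_def)
    have "insert x A \<in> max_chains (D y) le"
      unfolding mem_max_chains_iff chain_iff
    proof (intro conjI ballI impI)
      show "insert x A \<subseteq> D y" using A'(1) sub xy by (auto simp: D_def lt_in_def)
    next
      fix a b assume "a \<in> insert x A" "b \<in> insert x A"
      thus "a = b \<or> (a, b) \<in> le \<or> (b, a) \<in> le"
        using A'(1,2) by (auto simp: D_def lt_in_def)
    next
      fix z assume z: "z \<in> D y" "\<forall>c\<in>insert x A. z = c \<or> (z, c) \<in> le \<or> (c, z) \<in> le"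
      hence "z = x \<or> z \<in> D x" using nz[of z] by (auto simp: D_def lt_in_def)
      thus "z \<in> insert x A" using A'(3)[of z] z(2) by blast
    qed
    moreover have "x \<notin> A" using A'(1) by (auto simp: D_def lt_in_def)
    moreover have "finite A" using A'(1) fin by (auto simp: D_def intro: finite_subset)
    ultimately show "\<rho> y = \<rho> x + 1" using rho[OF xy(1) A] rho[OF xy(2)] by simp
  qed
  have wf: "wf (le - Id)"
    using partial_order_on_well_order_on[OF _ po] R(4) fin
    by (meson finite_SigmaI finite_subset)
  have uniq: "\<sigma> x = \<tau> x"
    if "x \<in> P" "is_rank_function P le \<sigma>" "is_rank_function P le \<tau>" for \<sigma> \<tau> x
    using wf that(1)
  proof (induction x rule: wf_induct_rule)
    case (less x)
    show ?case
    proof (cases "D x = {}")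
      case True
      hence "minimal_in P le x" using less.prems by (auto simp: minimal_in_def D_def)
      thus ?thesis using that(2,3) by (simp add: is_rank_function_def)
    next
      case False
      have "finite (le\<inverse>)"
        using fin R(4) by (meson finite_SigmaI finite_converse finite_subset)
      hence "wf (le\<inverse> - Id)"
        using po by (intro partial_order_on_well_order_on) simp_all
      moreover have "(le - Id)\<inverse> = le\<inverse> - Id" by auto
      ultimately have "wf ((le - Id)\<inverse>)" by simp
      moreover from False obtain v where "v \<in> D x" by blast
      ultimately obtain w where w: "w \<in> D x" "\<And>z. (z, w) \<in> (le - Id)\<inverse> \<Longrightarrow> z \<notin> D x"
        by (erule wfE_min)
      hence "covers P le x w"
        using less.prems by (auto simp: covers_def D_def lt_in_def)
      moreover have "\<sigma> w = \<tau> w"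
        using less.IH[of w] w(1) by (auto simp: D_def lt_in_def)
      ultimately show ?thesis using that(2,3) by (simp add: is_rank_function_def)
    qed
  qed
  show ?thesis
  proof (rule ex1I[of _ \<rho>])
    show "\<rho> \<in> extensional P \<and> is_rank_function P le \<rho>" using ex by (simp add: \<rho>_def)
  next
    fix \<sigma> assume s: "\<sigma> \<in> extensional P \<and> is_rank_function P le \<sigma>"
    show "\<sigma> = \<rho>"
    proof (rule extensionalityI[of _ P])
      show "\<rho> \<in> extensional P" by (simp add: \<rho>_def)
    qed (use s uniq[OF _ _ ex] in blast)+
  qed
qed

end

theory Submission
  imports Defs
begin

text \<open>
  A product of polynomials has its monomials among the products of their monomials, so \<open>f \<in> C\<^sub>P\<close>
  holds if and only if \<open>f\<close> counts, for some finite family of maximal chains, how often each point is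
  visited. In a pure poset the maximal chains are exactly the sequences \<open>x\<^sub>0, \<dots>, x\<^sub>r\<close> in which
  \<open>x\<^sub>i\<close> has rank \<open>i\<close> and \<open>x\<^sub>i\<^sub>+\<^sub>1\<close> covers \<open>x\<^sub>i\<close>. Hence a family of chains with visit counts \<open>f\<close>
  identifies the copies of each level with the index set of the family, and composing two
  consecutive identifications is a perfect matching. Conversely, following the matchings upwards
  from each copy of a minimal element gives a family of chains with visit counts \<open>f\<close>.
\<close>

section \<open>Monomials of the chain algebra\<close>

text \<open>A list rather than a set of chains, because a generator may occur several times in a
  product.\<close>

abbreviation visits :: "'a set list \<Rightarrow> 'a \<Rightarrow> nat" where
  "visits Cs x \<equiv> length (filter (\<lambda>C. x \<in> C) Cs)"

lemma max_chain_subset: "C \<in> max_chains P le \<Longrightarrow> C \<subseteq> P"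
  by (simp add: mem_max_chains_iff chain_iff)

lemma poly_var_power: "(poly_var x :: ('a, 'k::field) mpolynomial) ^ n =
    Poly_Mapping.single (Poly_Mapping.single x n) 1"
proof (induction n)
  case (Suc n)
  thus ?case
    by (simp add: poly_var_def mult_single flip: single_add)
qed simp

lemma prod_poly_var_power:
  assumes "finite S"
  shows "(\<Prod>x\<in>S. (poly_var x :: ('a, 'k::field) mpolynomial) ^ f x) =
    Poly_Mapping.single (\<Sum>x\<in>S. Poly_Mapping.single x (f x)) 1"
  using assms by (induction S rule: finite_induct) (simp_all add: poly_var_power mult_single)

lemma lookup_sum_single:
  assumes "finite S"
  shows "Poly_Mapping.lookup (\<Sum>x\<in>S. Poly_Mapping.single x (f x)) y = (f y when y \<in> S)"
  using assms by (simp add: lookup_sum lookup_single when_def)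

lemma prod_list_chain_monomial:
  assumes "finite P" "\<forall>C\<in>set Cs. C \<subseteq> P"
  shows "(prod_list (map chain_monomial Cs) :: ('a, 'k::field) mpolynomial) =
    (\<Prod>x\<in>P. poly_var x ^ visits Cs x)"
  using assms(2)
proof (induction Cs)
  case (Cons C Cs)
  \<comment> \<open>The product over \<open>C\<close> is padded to one over \<open>P\<close> with
    exponents 0 and 1, so that it merges factor by factor with the product for the remaining
    chains.\<close>
  have "chain_monomial C = (\<Prod>x\<in>P. (poly_var x :: ('a, 'k) mpolynomial) ^ of_bool (x \<in> C))"
    unfolding chain_monomial_def using assms(1) Cons.prems
    by (intro prod.mono_neutral_cong_left) auto
  with Cons show ?case
    by (simp flip: prod.distrib, intro prod.cong, auto)
qed simp

text \<open>The right-hand set is itself a subalgebra containing the generators, hence contains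
  their hull. It constrains only which monomials occur, so cancellation in sums and products does no
  harm.\<close>

lemma chain_algebra_supset:
  fixes P :: "'a set"
  assumes fin: "finite P"
  shows "(chain_algebra P le :: ('a, 'k::field) mpolynomial set) \<subseteq>
    {p. \<forall>m\<in>Poly_Mapping.keys p.
          \<exists>Cs. set Cs \<subseteq> max_chains P le \<and> (\<forall>x. Poly_Mapping.lookup m x = visits Cs x)}"
    (is "_ \<subseteq> ?A")
  unfolding chain_algebra_def
proof (rule hull_minimal)
  \<comment> \<open>A variable with positive exponent lies on some chain of the list, hence in
    \<open>P\<close>; this places the set inside \<open>poly_ring P\<close>.\<close>
  have gen: "Poly_Mapping.keys m \<subseteq> P" if "set Cs \<subseteq> max_chains P le"
    "\<forall>x. Poly_Mapping.lookup m x = visits Cs x" for m :: "'a \<Rightarrow>\<^sub>0 nat" and Cs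
  proof
    fix x assume "x \<in> Poly_Mapping.keys m"
    hence "filter (\<lambda>C. x \<in> C) Cs \<noteq> []" using that(2) by (auto simp: in_keys_iff)
    then obtain C where "C \<in> set Cs" "x \<in> C" by (auto simp: filter_empty_conv)
    thus "x \<in> P" using that(1) max_chain_subset by blast
  qed
  show "chain_monomial ` max_chains P le \<subseteq> ?A"
  proof clarify
    fix C m assume C: "C \<in> max_chains P le"
      and m: "m \<in> Poly_Mapping.keys (chain_monomial C :: ('a, 'k) mpolynomial)"
    have finC: "finite C" using max_chain_subset[OF C] fin by (rule finite_subset)
    have "m = (\<Sum>x\<in>C. Poly_Mapping.single x 1)"
      using m prod_poly_var_power[OF finC, of "\<lambda>_. 1", where 'k = 'k]
      by (simp add: chain_monomial_def)
    hence "\<forall>x. Poly_Mapping.lookup m x = visits [C] x"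
      by (simp add: lookup_sum_single[OF finC])
    thus "\<exists>Cs. set Cs \<subseteq> max_chains P le \<and> (\<forall>x. Poly_Mapping.lookup m x = visits Cs x)"
      using C by (intro exI[of _ "[C]"]) simp
  qed
  show "is_subalgebra P ?A"
    unfolding is_subalgebra_def
  proof (intro conjI ballI allI)
    show "?A \<subseteq> poly_ring P" using gen by (fastforce simp: poly_ring_def)
    show "1 \<in> ?A" by (auto intro: exI[of _ "[]"])
  next
    fix p q assume "p \<in> ?A" "q \<in> ?A"
    thus "p + q \<in> ?A" using keys_add[of p q] by blast
  next
    fix p q assume pq: "p \<in> ?A" "q \<in> ?A"
    show "p * q \<in> ?A"
    proof clarify
      fix m assume "m \<in> Poly_Mapping.keys (p * q)"
      then obtain a b where ab: "a \<in> Poly_Mapping.keys p" "b \<in> Poly_Mapping.keys q" "m = a + b"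
        using keys_mult[of p q] by blast
      from ab(1) pq(1) obtain As where "set As \<subseteq> max_chains P le" "\<forall>x. Poly_Mapping.lookup a x = visits As x"
        by blast
      moreover from ab(2) pq(2) obtain Bs
        where "set Bs \<subseteq> max_chains P le" "\<forall>x. Poly_Mapping.lookup b x = visits Bs x"
        by blast
      \<comment> \<open>Multiplying monomials adds exponents, and concatenating lists adds visit
        counts.\<close>
      ultimately show "\<exists>Cs. set Cs \<subseteq> max_chains P le \<and> (\<forall>x. Poly_Mapping.lookup m x = visits Cs x)"
        using ab(3) by (intro exI[of _ "As @ Bs"]) (simp add: lookup_add)
    qed
  next
    fix c :: 'k and p assume "p \<in> ?A"
    moreover have "Poly_Mapping.keys (poly_const c * p) \<subseteq> Poly_Mapping.keys p"
      using keys_mult[of "poly_const c" p] by (fastforce simp: poly_const_def split: if_splits)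
    ultimately show "poly_const c * p \<in> ?A" by blast
  qed
qed

text \<open>The right-hand side no longer mentions the field: membership becomes a purely
  combinatorial condition.\<close>

lemma mem_chain_semigroup_iff:
  assumes fin: "finite P"
  shows "f \<in> chain_semigroup TYPE('k::field) P le \<longleftrightarrow>
    (\<exists>Cs. set Cs \<subseteq> max_chains P le \<and> (\<forall>x\<in>P. f x = visits Cs x))"
    (is "?L \<longleftrightarrow> ?R")
proof
  assume ?L
  hence "Poly_Mapping.single (\<Sum>x\<in>P. Poly_Mapping.single x (f x)) (1::'k) \<in> chain_algebra P le"
    by (simp add: chain_semigroup_def prod_poly_var_power[OF fin])
  \<comment> \<open>As 1 is nonzero in a field, the exponent vector of \<open>f\<close> really is a
    key of this polynomial.\<close>
  from subsetD[OF chain_algebra_supset[OF fin] this]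
  obtain Cs where "set Cs \<subseteq> max_chains P le"
    "\<forall>y. Poly_Mapping.lookup (\<Sum>x\<in>P. Poly_Mapping.single x (f x)) y = visits Cs y"
    by auto
  thus ?R
    using lookup_sum_single[OF fin, of f] by (metis (full_types) when_simps(1))
next
  assume ?R
  then obtain Cs where Cs: "set Cs \<subseteq> max_chains P le" "\<forall>x\<in>P. f x = visits Cs x" by blast
  have "prod_list (map chain_monomial Cs) \<in> A"
    if "is_subalgebra P A" "chain_monomial ` max_chains P le \<subseteq> A"
    for A :: "('a, 'k) mpolynomial set"
    using Cs(1) that by (induction Cs) (auto simp: is_subalgebra_def)
  hence "prod_list (map chain_monomial Cs) \<in> (chain_algebra P le :: ('a, 'k) mpolynomial set)"
    by (auto simp: chain_algebra_def hull_def)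
  also have "prod_list (map chain_monomial Cs) =
      (\<Prod>x\<in>P. (poly_var x :: ('a, 'k) mpolynomial) ^ f x)"
    using Cs max_chain_subset[of _ P le]
    by (subst prod_list_chain_monomial[OF fin]) auto
  finally show ?L by (simp add: chain_semigroup_def)
qed


section \<open>Maximal chains of a pure poset\<close>

locale finite_pure_poset =
  fixes P :: "'a set" and le :: "'a rel" and r :: nat
  assumes fin: "finite P" and po: "partial_order_on P le" and pure: "pure_of_rank P le r"
begin

abbreviation "\<rho> \<equiv> rank_of P le"

lemma le_trans: "(a, b) \<in> le \<Longrightarrow> (b, c) \<in> le \<Longrightarrow> (a, c) \<in> le"
  using partial_order_onD(2)[OF po] by (auto dest: transD)

lemma le_antisym: "(a, b) \<in> le \<Longrightarrow> (b, a) \<in> le \<Longrightarrow> a = b"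
  using partial_order_onD(3)[OF po] by (auto dest: antisymD)

lemma le_refl: "a \<in> P \<Longrightarrow> (a, a) \<in> le"
  using partial_order_onD(1)[OF po] by (auto simp: refl_on_def)

lemma le_carrier: "(a, b) \<in> le \<Longrightarrow> a \<in> P \<and> b \<in> P"
  using partial_order_onD(4)[OF po] by auto

lemma rank_function: "is_rank_function P le \<rho>"
  unfolding rank_of_def
  using theI'[OF rank_function_exists_unique[OF fin po pure]] by blast

lemma rank_minimal: "minimal_in P le m \<Longrightarrow> \<rho> m = 0"
  using rank_function by (simp add: is_rank_function_def)

lemma rank_covers: "covers P le y x \<Longrightarrow> \<rho> y = Suc (\<rho> x)"
  using rank_function by (simp add: is_rank_function_def)

lemma max_chain_total:
  "C \<in> max_chains P le \<Longrightarrow> x \<in> C \<Longrightarrow> y \<in> C \<Longrightarrow> x = y \<or> (x, y) \<in> le \<or> (y, x) \<in> le"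
  by (simp add: mem_max_chains_iff chain_iff)

lemma max_chain_closed:
  "C \<in> max_chains P le \<Longrightarrow> z \<in> P \<Longrightarrow> (\<And>c. c \<in> C \<Longrightarrow> z = c \<or> (z, c) \<in> le \<or> (c, z) \<in> le) \<Longrightarrow> z \<in> C"
  by (simp add: mem_max_chains_iff)

lemma finite_max_chain: "C \<in> max_chains P le \<Longrightarrow> finite C"
  using max_chain_subset fin finite_subset by metis

lemma ex_max_chain_supset:
  assumes "pred_on.chain P (lt_in le) S"
  shows "\<exists>C\<in>max_chains P le. S \<subseteq> C"
proof -
  have "finite {C. pred_on.chain P (lt_in le) C}"
    by (rule finite_subset[of _ "Pow P"]) (auto simp: chain_iff fin)
  then obtain C where "pred_on.chain P (lt_in le) C" "S \<subseteq> C"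
    "\<And>D. pred_on.chain P (lt_in le) D \<Longrightarrow> C \<subseteq> D \<Longrightarrow> C = D"
    using finite_has_maximal2[of _ S] assms by (metis (no_types, lifting) mem_Collect_eq)
  thus ?thesis
    by (intro bexI[of _ C]) (auto simp: max_chains_def pred_on.maxchain_def)
qed

text \<open>Take \<open>x\<close> to be the largest element of \<open>C\<close> strictly below
  \<open>y\<close>. A point strictly between \<open>x\<close> and \<open>y\<close> would be
  comparable with all of \<open>C\<close>, hence lie in \<open>C\<close> by maximality,
  contradicting the choice of \<open>x\<close>.\<close>

lemma max_chain_cover_below:
  assumes C: "C \<in> max_chains P le" and y: "y \<in> C" and w: "w \<in> C" "lt_in le w y"
  shows "\<exists>x\<in>C. covers P le y x \<and> (\<forall>c\<in>C. lt_in le c y \<longrightarrow> (c, x) \<in> le)"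
proof -
  define B where "B = {c\<in>C. lt_in le c y}"
  \<comment> \<open>In a finite order the reversed strict relation is well-founded, so its minimal
    elements provide a maximal element of \<open>B\<close>; totality of \<open>C\<close> makes it
    the greatest.\<close>
  have "wf ((le - Id)\<inverse>)"
  proof -
    have "finite (le\<inverse>)"
      using fin partial_order_onD(4)[OF po] by (meson finite_SigmaI finite_converse finite_subset)
    hence "wf (le\<inverse> - Id)"
      using po by (intro partial_order_on_well_order_on) simp_all
    moreover have "(le - Id)\<inverse> = le\<inverse> - Id" by auto
    ultimately show ?thesis by simp
  qed
  moreover have "w \<in> B" using w by (simp add: B_def)
  ultimately obtain x where x: "x \<in> B" "\<And>z. (z, x) \<in> (le - Id)\<inverse> \<Longrightarrow> z \<notin> B"
    by (erule wfE_min)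
  have x': "x \<in> C" "(x, y) \<in> le" "x \<noteq> y" using x(1) by (auto simp: B_def lt_in_def)
  have top: "(c, x) \<in> le" if "c \<in> C" "lt_in le c y" for c
    using max_chain_total[OF C that(1) x'(1)] x(2)[of c] that x'(1,2) le_carrier le_refl
    by (auto simp: B_def)
  have "\<not> (lt_in le x z \<and> lt_in le z y)" for z
  proof
    assume z: "lt_in le x z \<and> lt_in le z y"
    hence "z \<in> P" using le_carrier by (auto simp: lt_in_def)
    moreover have "z = c \<or> (z, c) \<in> le \<or> (c, z) \<in> le" if c: "c \<in> C" for c
    proof (cases "lt_in le c y")
      case True
      with top[OF c] z le_trans show ?thesis unfolding lt_in_def by blast
    next
      case False
      hence "c = y \<or> (y, c) \<in> le" using max_chain_total[OF C c y] by (auto simp: lt_in_def)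
      with z le_trans show ?thesis unfolding lt_in_def by blast
    qed
    ultimately have "z \<in> C" by (rule max_chain_closed[OF C])
    with top z show False using le_antisym unfolding lt_in_def by blast
  qed
  hence "covers P le y x"
    using x' le_carrier[OF x'(2)] by (auto simp: covers_def lt_in_def)
  with x' top show ?thesis by blast
qed

text \<open>Descend from \<open>y\<close> to the element of \<open>C\<close> that it covers: the
  rank drops by one, and that element is still above or equal to \<open>x\<close>.\<close>

lemma max_chain_rank_less:
  assumes C: "C \<in> max_chains P le" and "x \<in> C" "y \<in> C" "lt_in le x y"
  shows "\<rho> x < \<rho> y"
  using assms(3,4)
proof (induction "\<rho> y" arbitrary: y rule: less_induct)
  case less
  obtain z where z: "z \<in> C" "covers P le y z" "(x, z) \<in> le"
    using max_chain_cover_below[OF C less.prems(1) \<open>x \<in> C\<close> less.prems(2)] \<open>x \<in> C\<close> less.prems(2)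
    by blast
  have zy: "\<rho> y = Suc (\<rho> z)" using rank_covers z(2) .
  show ?case
  proof (cases "x = z")
    case False
    hence "\<rho> x < \<rho> z" using less.hyps[of z] z zy by (simp add: lt_in_def)
    thus ?thesis using zy by simp
  qed (simp add: zy)
qed

text \<open>Two comparable points lie on a common maximal chain, so the previous result extends from
  chains to all of \<open>P\<close>.\<close>

lemma rank_less:
  assumes "lt_in le x y"
  shows "\<rho> x < \<rho> y"
proof -
  have "pred_on.chain P (lt_in le) {x, y}"
    using assms le_carrier by (auto simp: chain_iff lt_in_def)
  with ex_max_chain_supset obtain C where "C \<in> max_chains P le" "{x, y} \<subseteq> C" by blast
  with max_chain_rank_less assms show ?thesis by blast
qed

lemma max_chain_inj_rank:
  assumes C: "C \<in> max_chains P le"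
  shows "inj_on \<rho> C"
proof (rule inj_onI)
  fix x y assume "x \<in> C" "y \<in> C" "\<rho> x = \<rho> y"
  thus "x = y"
    using max_chain_total[OF C] rank_less[of x y] rank_less[of y x] by (auto simp: lt_in_def)
qed

text \<open>Positive rank means that some \<open>z\<close> in \<open>P\<close> lies below
  \<open>y\<close>. If \<open>y\<close> were the least element of \<open>C\<close>, then
  \<open>z\<close> would be below all of \<open>C\<close>, and maximality would put it into
  \<open>C\<close>.\<close>

lemma max_chain_cover:
  assumes C: "C \<in> max_chains P le" and y: "y \<in> C" "\<rho> y = Suc n"
  shows "\<exists>x\<in>C. covers P le y x"
proof -
  have yP: "y \<in> P" using max_chain_subset[OF C] y(1) by blast
  have "\<not> minimal_in P le y" using rank_minimal y(2) by force
  then obtain z where z: "z \<in> P" "lt_in le z y" using yP by (auto simp: minimal_in_def)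
  have "\<exists>w\<in>C. lt_in le w y"
  proof (rule ccontr)
    assume no: "\<not> (\<exists>w\<in>C. lt_in le w y)"
    have "(z, c) \<in> le" if "c \<in> C" for c
      using max_chain_total[OF C that y(1)] no that z(2) le_trans unfolding lt_in_def by blast
    hence "z \<in> C" using max_chain_closed[OF C z(1)] by blast
    with no z(2) show False by blast
  qed
  thus ?thesis using max_chain_cover_below[OF C y(1)] by blast
qed

text \<open>The ranks on \<open>C\<close> are distinct and closed downwards, since each element of
  positive rank covers another element of \<open>C\<close>. Purity says that there are
  \<open>r + 1\<close> of them, which leaves only 0 up to \<open>r\<close>.\<close>

lemma max_chain_bij_rank:
  assumes C: "C \<in> max_chains P le"
  shows "bij_betw \<rho> C {..r}"
proof -
  have down: "{..n} \<subseteq> \<rho> ` C" if "n \<in> \<rho> ` C" for n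
    using that
  proof (induction n)
    case (Suc n)
    then obtain y where y: "y \<in> C" "\<rho> y = Suc n" by force
    from max_chain_cover[OF C this] obtain x where "x \<in> C" "covers P le y x" by blast
    hence "n \<in> \<rho> ` C" using rank_covers[of y x] y(2) by force
    with Suc show ?case by (simp add: atMost_Suc)
  qed simp
  have card: "card (\<rho> ` C) = Suc r"
    using pure C card_image[OF max_chain_inj_rank[OF C]]
    by (force simp: pure_of_rank_def chain_length_def)
  have finI: "finite (\<rho> ` C)" using finite_max_chain[OF C] by simp
  have "\<rho> ` C \<subseteq> {..r}"
  proof
    fix n assume "n \<in> \<rho> ` C"
    \<comment> \<open>With \<open>n\<close> all \<open>n + 1\<close> ranks up to \<open>n\<close>
      occur, so \<open>n + 1 \<le> r + 1\<close>.\<close>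
    from card_mono[OF finI down[OF this]] card show "n \<in> {..r}" by simp
  qed
  hence "\<rho> ` C = {..r}" using card by (intro card_subset_eq) auto
  thus ?thesis using max_chain_inj_rank[OF C] by (simp add: bij_betw_def)
qed

lemma rank_le:
  assumes "x \<in> P"
  shows "\<rho> x \<le> r"
proof -
  have "pred_on.chain P (lt_in le) {x}" using assms by (simp add: chain_iff)
  with ex_max_chain_supset obtain C where C: "C \<in> max_chains P le" "x \<in> C" by blast
  with bij_betw_imp_surj_on[OF max_chain_bij_rank[OF C(1)]] show ?thesis by auto
qed

lemma ex1_max_chain_level:
  assumes C: "C \<in> max_chains P le" and "i \<le> r"
  shows "\<exists>!x. x \<in> C \<and> \<rho> x = i"
proof (rule ex_ex1I)
  show "\<exists>x. x \<in> C \<and> \<rho> x = i"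
    using bij_betw_imp_surj_on[OF max_chain_bij_rank[OF C]] \<open>i \<le> r\<close> by force
qed (use inj_onD[OF max_chain_inj_rank[OF C]] in metis)

text \<open>\<open>y\<close> covers some element of \<open>C\<close>, which has the same rank as
  \<open>x\<close> and therefore is \<open>x\<close>.\<close>

lemma max_chain_covers:
  assumes C: "C \<in> max_chains P le" and "x \<in> C" "y \<in> C" "\<rho> y = Suc (\<rho> x)"
  shows "covers P le y x"
proof -
  obtain z where z: "z \<in> C" "covers P le y z" using max_chain_cover[OF C assms(3,4)] by blast
  hence "\<rho> z = \<rho> x" using rank_covers[of y z] assms(4) by simp
  hence "z = x" using max_chain_inj_rank[OF C] z(1) assms(2) by (auto dest: inj_onD)
  thus ?thesis using z(2) by simp
qed

text \<open>Nothing can be added to the chain: every \<open>z\<close> in \<open>P\<close> has a rank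
  at most \<open>r\<close>, so the sequence has a member of that rank, and distinct points of equal
  rank are incomparable.\<close>

lemma covers_sequence_max_chain:
  assumes level: "\<And>i. i \<le> r \<Longrightarrow> c i \<in> level P le i"
    and covers: "\<And>i. i < r \<Longrightarrow> covers P le (c (Suc i)) (c i)"
  shows "c ` {..r} \<in> max_chains P le"
proof -
  have le: "(c i, c j) \<in> le" if "i \<le> j" "j \<le> r" for i j
    using that
  proof (induction j rule: dec_induct)
    case base
    thus ?case using level le_refl by (simp add: level_def)
  next
    case (step n)
    hence "(c n, c (Suc n)) \<in> le" using covers[of n] by (simp add: covers_def lt_in_def)
    with step show ?case using le_trans[of "c i" "c n"] by simp
  qed
  show ?thesis
    unfolding mem_max_chains_iff chain_iff
  proof (intro conjI ballI impI)
    show "c ` {..r} \<subseteq> P" using level by (auto simp: level_def)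
  next
    fix x y assume "x \<in> c ` {..r}" "y \<in> c ` {..r}"
    then obtain i j where "i \<le> r" "j \<le> r" "x = c i" "y = c j" by auto
    thus "x = y \<or> (x, y) \<in> le \<or> (y, x) \<in> le" using le nat_le_linear[of i j] by blast
  next
    fix z assume z: "z \<in> P" "\<forall>x\<in>c ` {..r}. z = x \<or> (z, x) \<in> le \<or> (x, z) \<in> le"
    have i: "\<rho> z \<le> r" using rank_le[OF z(1)] .
    hence "\<rho> (c (\<rho> z)) = \<rho> z" using level by (simp add: level_def)
    hence "z = c (\<rho> z)"
      using z(2) i rank_less[of z "c (\<rho> z)"] rank_less[of "c (\<rho> z)" z]
      by (metis atMost_iff imageI less_irrefl lt_in_def)
    thus "z \<in> c ` {..r}" using i by blast
  qed
qed

end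


section \<open>Matchings and families of chains\<close>

text \<open>Number the elements of each fibre of \<open>g\<close> from 1 to \<open>f x\<close>; then
  \<open>h\<close> sends \<open>j\<close> to the copy of \<open>g j\<close> carrying the number of
  \<open>j\<close>.\<close>

lemma ex_bij_betw_copies:
  assumes finJ: "finite J" and g: "g ` J \<subseteq> S"
    and f: "\<And>x. x \<in> S \<Longrightarrow> f x = card {j\<in>J. g j = x}"
  shows "\<exists>h. bij_betw h J (copies f S) \<and> (\<forall>j\<in>J. fst (h j) = g j)"
proof -
  have "\<exists>e. bij_betw e {j\<in>J. g j = x} {1..f x}" if "x \<in> S" for x
    using finJ f[OF that] by (intro finite_same_card_bij) auto
  then obtain e where e: "\<And>x. x \<in> S \<Longrightarrow> bij_betw (e x) {j\<in>J. g j = x} {1..f x}" by metis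
  define h where "h j = (g j, e (g j) j)" for j
  have "inj_on h J"
  proof (rule inj_onI)
    fix i j assume ij: "i \<in> J" "j \<in> J" "h i = h j"
    hence "inj_on (e (g j)) {k\<in>J. g k = g j}" using e[of "g j"] g by (auto simp: bij_betw_def)
    with ij show "i = j" unfolding h_def inj_on_def
      by (metis (mono_tags, lifting) Pair_inject mem_Collect_eq)
  qed
  moreover have "h ` J = copies f S"
  proof
    show "h ` J \<subseteq> copies f S"
    proof (rule image_subsetI)
      fix j assume "j \<in> J"
      with g e[of "g j"] show "h j \<in> copies f S" by (fastforce simp: h_def copies_def bij_betw_def)
    qed
    show "copies f S \<subseteq> h ` J"
    proof clarify
      fix x k assume "(x, k) \<in> copies f S"
      hence "x \<in> S" "k \<in> {1..f x}" by (auto simp: copies_def)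
      with bij_betw_imp_surj_on[OF e[of x]] have "k \<in> e x ` {j\<in>J. g j = x}" by simp
      then obtain j where "j \<in> J" "g j = x" "k = e x j" by blast
      thus "(x, k) \<in> h ` J" by (auto simp: h_def)
    qed
  qed
  ultimately show ?thesis by (intro exI[of _ h]) (simp add: bij_betw_def h_def)
qed

context finite_pure_poset
begin

text \<open>A bijection between the two sides keeps both endpoints in range, so only the covering
  condition remains of the edge set.\<close>

lemma perfect_matching_iff:
  "perfect_matching (parallel_graph P le f i) \<phi> \<longleftrightarrow>
    bij_betw \<phi> (copies f (level P le i)) (copies f (level P le (Suc i))) \<and>
    (\<forall>a\<in>copies f (level P le i). covers P le (fst (\<phi> a)) (fst a))"
proof -
  let ?V = "\<lambda>i. copies f (level P le i)"
  have "(a, b) \<in> {((x, k), (y, l)) | x k y l.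
      (x, k) \<in> ?V i \<and> (y, l) \<in> ?V (Suc i) \<and> covers P le y x} \<longleftrightarrow> covers P le (fst b) (fst a)"
    if "a \<in> ?V i" "b \<in> ?V (Suc i)" for a b
    using that by (cases a; cases b) auto
  with bij_betw_apply[of \<phi> "?V i" "?V (Suc i)"] show ?thesis
    unfolding perfect_matching_def parallel_graph_def Let_def Suc_eq_plus1 prod.case
    by (intro conj_cong ball_cong) blast+
qed

lemma perfect_matching_if_visits:
  assumes Cs: "set Cs \<subseteq> max_chains P le" and f: "\<forall>x\<in>P. f x = visits Cs x" and "i < r"
  shows "\<exists>\<phi>. perfect_matching (parallel_graph P le f i) \<phi>"
proof -
  define J where "J = {..<length Cs}"
  \<comment> \<open>The point where the \<open>j\<close>-th chain meets rank \<open>k\<close>,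
    unique for \<open>k \<le> r\<close>.\<close>
  define c where "c k j = (THE x. x \<in> Cs ! j \<and> \<rho> x = k)" for k j
  have mc: "Cs ! j \<in> max_chains P le" if "j \<in> J" for j
    using that Cs by (auto simp: J_def)
  have c: "c k j \<in> Cs ! j \<and> \<rho> (c k j) = k" if "j \<in> J" "k \<le> r" for j k
    unfolding c_def using theI'[OF ex1_max_chain_level[OF mc]] that by blast
  have c_eq: "c k j = x \<longleftrightarrow> x \<in> Cs ! j" if "j \<in> J" "k \<le> r" "\<rho> x = k" for j k x
    using ex1_max_chain_level[OF mc] c that by metis
  have "\<exists>h. bij_betw h J (copies f (level P le k)) \<and> (\<forall>j\<in>J. fst (h j) = c k j)" if k: "k \<le> r" for k
  proof (rule ex_bij_betw_copies)
    show "finite J" by (simp add: J_def)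
    show "c k ` J \<subseteq> level P le k"
      using c[OF _ k] mc max_chain_subset by (fastforce simp: level_def)
    fix x assume x: "x \<in> level P le k"
    \<comment> \<open>For \<open>x\<close> of rank \<open>k\<close>, the fibre over \<open>x\<close>
      consists of the indices of the chains through \<open>x\<close>, and \<open>f x\<close> counts
      these.\<close>
    hence "{j\<in>J. c k j = x} = {j. j < length Cs \<and> x \<in> Cs ! j}"
      using c_eq[OF _ k] by (auto simp: level_def J_def)
    thus "f x = card {j\<in>J. c k j = x}"
      using f x by (simp add: level_def length_filter_conv_card)
  qed
  then obtain h where h: "\<And>k. k \<le> r \<Longrightarrow> bij_betw (h k) J (copies f (level P le k))"
    "\<And>k j. k \<le> r \<Longrightarrow> j \<in> J \<Longrightarrow> fst (h k j) = c k j"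
    by metis
  \<comment> \<open>From a copy at rank \<open>i\<close> back to the index of its chain, then on to
    the copy assigned to the same chain at rank \<open>i + 1\<close>.\<close>
  define \<phi> where "\<phi> = h (Suc i) \<circ> inv_into J (h i)"
  have "perfect_matching (parallel_graph P le f i) \<phi>"
    unfolding perfect_matching_iff
  proof (intro conjI ballI)
    show "bij_betw \<phi> (copies f (level P le i)) (copies f (level P le (Suc i)))"
      unfolding \<phi>_def using h(1) \<open>i < r\<close>
      by (meson Suc_leI bij_betw_inv_into bij_betw_trans less_imp_le_nat)
  next
    fix a assume "a \<in> copies f (level P le i)"
    then obtain j where j: "j \<in> J" "a = h i j"
      using h(1)[of i] \<open>i < r\<close> by (auto simp: bij_betw_def)
    hence "\<phi> a = h (Suc i) j"
      using h(1)[of i] \<open>i < r\<close> by (simp add: \<phi>_def bij_betw_def)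
    moreover have "covers P le (c (Suc i) j) (c i j)"
      using c[OF j(1), of i] c[OF j(1), of "Suc i"] \<open>i < r\<close> max_chain_covers[OF mc[OF j(1)]] by simp
    ultimately show "covers P le (fst (\<phi> a)) (fst a)"
      using h(2) j \<open>i < r\<close> by simp
  qed
  thus ?thesis by blast
qed

lemma visits_if_perfect_matching:
  assumes "\<And>i. i < r \<Longrightarrow> \<exists>\<phi>. perfect_matching (parallel_graph P le f i) \<phi>"
  shows "\<exists>Cs. set Cs \<subseteq> max_chains P le \<and> (\<forall>x\<in>P. f x = visits Cs x)"
proof -
  from assms obtain \<phi> where \<phi>: "\<And>i. i < r \<Longrightarrow> perfect_matching (parallel_graph P le f i) (\<phi> i)"
    by metis
  define V where "V i = copies f (level P le i)" for i
  \<comment> \<open>\<open>s i v\<close> is the copy at rank \<open>i\<close> reached from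
    \<open>v\<close> by following the matchings; it is meaningful for \<open>i \<le> r\<close>
    only.\<close>
  define s where "s = rec_nat (\<lambda>v. v) (\<lambda>i t v. \<phi> i (t v))"
  have s_0: "s 0 v = v" and s_Suc: "s (Suc i) v = \<phi> i (s i v)" for i v
    by (simp_all add: s_def)
  have bij: "bij_betw (s i) (V 0) (V i)" if "i \<le> r" for i
    using that
  proof (induction i)
    case 0
    thus ?case by (simp add: bij_betw_def inj_on_def s_0)
  next
    case (Suc i)
    hence "bij_betw (\<phi> i \<circ> s i) (V 0) (V (Suc i))"
      using \<phi>[of i] unfolding perfect_matching_iff V_def
      by (auto intro: bij_betw_trans)
    thus ?case by (simp add: s_Suc comp_def cong: bij_betw_cong)
  qed
  have s_level: "fst (s i v) \<in> level P le i" if "v \<in> V 0" "i \<le> r" for i v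
    using bij_betwE[OF bij[OF that(2)]] that(1) by (force simp: V_def copies_def)
  define C where "C v = (\<lambda>i. fst (s i v)) ` {..r}" for v
  have C: "C v \<in> max_chains P le" if v: "v \<in> V 0" for v
    unfolding C_def
  proof (rule covers_sequence_max_chain)
    fix i assume "i < r"
    moreover from this have "s i v \<in> V i" using bij[of i] v by (auto dest: bij_betwE)
    ultimately show "covers P le (fst (s (Suc i) v)) (fst (s i v))"
      using \<phi>[of i] by (simp add: perfect_matching_iff V_def s_Suc)
  qed (rule s_level[OF v])
  have "finite (V 0)"
    using fin by (auto simp: V_def copies_def level_def)
  \<comment> \<open>One chain is taken per copy at rank 0. Different copies may yield the same
    chain, and the list keeps the multiplicity.\<close>
  then obtain vs where vs: "set vs = V 0" "distinct vs" using finite_distinct_list by blast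
  have "f x = visits (map C vs) x" if x: "x \<in> P" for x
  proof -
    let ?i = "\<rho> x"
    have i: "?i \<le> r" using rank_le[OF x] .
    \<comment> \<open>\<open>C v\<close> has its rank \<open>j\<close> member at position
      \<open>j\<close>, so it can meet \<open>x\<close> only at position
      \<open>\<rho> x\<close>.\<close>
    have mem: "x \<in> C v \<longleftrightarrow> fst (s ?i v) = x" if "v \<in> V 0" for v
    proof
      assume "x \<in> C v"
      then obtain j where j: "j \<le> r" "x = fst (s j v)" by (auto simp: C_def)
      hence "\<rho> x = j" using s_level[OF that j(1)] by (simp add: level_def)
      thus "fst (s ?i v) = x" using j(2) by simp
    next
      assume "fst (s ?i v) = x"
      thus "x \<in> C v" using i by (force simp: C_def)
    qed
    \<comment> \<open>The chains through \<open>x\<close> thus correspond to the copies of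
      \<open>x\<close>, of which there are \<open>f x\<close>.\<close>
    have "bij_betw (s ?i) {v\<in>V 0. fst (s ?i v) = x} {w\<in>V ?i. fst w = x}"
    proof (rule bij_betw_subset[OF bij[OF i]])
      show "s ?i ` {v\<in>V 0. fst (s ?i v) = x} = {w\<in>V ?i. fst w = x}"
        unfolding bij_betw_imp_surj_on[OF bij[OF i], symmetric] by blast
    qed auto
    hence "card {v\<in>V 0. fst (s ?i v) = x} = card {w\<in>V ?i. fst w = x}"
      by (rule bij_betw_same_card)
    also have "{w\<in>V ?i. fst w = x} = {x} \<times> {1..f x}"
      using x by (auto simp: V_def copies_def level_def)
    finally have "card {v\<in>V 0. fst (s ?i v) = x} = f x"
      by (simp add: card_cartesian_product)
    moreover have "{v. x \<in> C v} \<inter> set vs = {v\<in>V 0. fst (s ?i v) = x}"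
      using mem vs(1) by auto
    ultimately show ?thesis
      using distinct_length_filter[OF vs(2), of "\<lambda>v. x \<in> C v"] by (simp add: filter_map comp_def)
  qed
  moreover have "set (map C vs) \<subseteq> max_chains P le" using C vs(1) by auto
  ultimately show ?thesis by blast
qed

end

theorem lemma3p2:
  fixes P :: "'a set" and le :: "'a rel" and r :: nat and f :: "'a \<Rightarrow> nat"
  assumes "finite P"
    and "partial_order_on P le"
    and "pure_of_rank P le r"
  shows "f \<in> chain_semigroup TYPE('k::field) P le \<longleftrightarrow>
           (\<forall>i<r. \<exists>\<phi>. perfect_matching (parallel_graph P le f i) \<phi>)"
proof -
  interpret finite_pure_poset P le r using assms by unfold_locales
  show ?thesis
    unfolding mem_chain_semigroup_iff[OF assms(1)]
    using perfect_matching_if_visits visits_if_perfect_matching by metis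
qed

end
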